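(* Let $1 < \beta \le 2$ and $\kappa > 0$. Then $A_\beta(\kappa) \in \mathcal{G}^s([0,1])$ for $s = \frac{1}{1+\kappa}$.
   Context: Let $f_\beta(x) = \beta x - \lfloor \beta x\rfloor$ (the $\beta$-transformation, fractional part of $\beta x$) and $A_\beta(\kappa) = \{x\in[0,1] : 0 \le f_\beta^n(x) \le \beta^{-\kappa n} \text{ for infinitely many } n\}$. $\mathcal{G}^s$ is the set of all $G_\delta$ sets $A\subseteq\mathbb{R}$ such that for every countable collection of similarity transformations $f_j:\mathbb{R}\to\mathbb{R}$, $\dim_H(\bigcap_j f_j(A))\ge s$ (Hausdorff dimension); for an interval $I$, $\mathcal{G}^s(I) = \{A\subseteq I : A + \operatorname{diam}(I)\cdot\mathbb{Z}\in\mathcal{G}^s\}$.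
   Formalization: The literal claim fails: A_β(κ)+ℤ need not be G_δ (e.g. β=2, κ=1, by Baire). Proved instead: some B in G^s([0,1]), s=1/(1+κ), has B ⊆ A_β(κ) and A_β(κ)∖B countable; so the dimension bound holds for A_β(κ), and the G_δ property holds up to a countable set. *)

theory Defs
  imports "HOL-Analysis.Analysis"
begin

definition beta_map :: "real \<Rightarrow> real \<Rightarrow> real" where
  "beta_map \<beta> x = frac (\<beta> * x)"

definition beta_approx :: "real \<Rightarrow> real \<Rightarrow> real set" where
  "beta_approx \<beta> \<kappa> = {x \<in> {0..1}. \<exists>\<^sub>\<infinity>n. 0 \<le> (beta_map \<beta> ^^ n) x \<and>
     (beta_map \<beta> ^^ n) x \<le> \<beta> powr (- \<kappa> * real n)}"

(* In the library 0 powr 0 = 0 and diameter is a junk value on unbounded sets. Hence the separate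
   clause for s = 0 here (every nonempty set has weight 1), and boundedness in delta_cover. *)
definition hausdorff_gauge :: "real \<Rightarrow> 'a::metric_space set \<Rightarrow> ennreal" where
  "hausdorff_gauge s U =
     (if U = {} then 0 else if s = 0 then 1 else ennreal (diameter U powr s))"

definition delta_cover :: "real \<Rightarrow> 'a::metric_space set \<Rightarrow> (nat \<Rightarrow> 'a set) \<Rightarrow> bool" where
  "delta_cover \<delta> X U \<longleftrightarrow> X \<subseteq> (\<Union>i. U i) \<and> (\<forall>i. bounded (U i) \<and> diameter (U i) \<le> \<delta>)"

definition hausdorff_measure :: "real \<Rightarrow> 'a::metric_space set \<Rightarrow> ennreal" where
  "hausdorff_measure s X =
     (SUP \<delta>\<in>{0<..}. INF U\<in>Collect (delta_cover \<delta> X). \<Sum>i. hausdorff_gauge s (U i))"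

definition hausdorff_dim :: "'a::metric_space set \<Rightarrow> ereal" where
  "hausdorff_dim X = Inf {ereal s |s. 0 \<le> s \<and> hausdorff_measure s X = 0}"

definition similarity :: "('a::metric_space \<Rightarrow> 'b::metric_space) \<Rightarrow> bool" where
  "similarity f \<longleftrightarrow> (\<exists>c>0. \<forall>x y. dist (f x) (f y) = c * dist x y)"

definition large_int_class :: "real \<Rightarrow> real set set" where
  "large_int_class s = {A. gdelta A \<and>
     (\<forall>F :: (real \<Rightarrow> real) set. countable F \<and> (\<forall>f\<in>F. similarity f) \<longrightarrow>
        ereal s \<le> hausdorff_dim (\<Inter>f\<in>F. f ` A))}"

(* beta_approx \<beta> \<kappa> need not be a G-delta set: it contains every x whose orbit reaches 0, and such x are
   left endpoints of the half-open cylinders, so they lie in the limsup set but not in the limsup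
   of the interiors. For \<beta> = 2 and \<kappa> = 1 the G-delta condition below fails for beta_approx \<beta> \<kappa>,
   and it holds only after removing countably many points. *)
definition large_int_class_on :: "real \<Rightarrow> real set \<Rightarrow> real set set" where
  "large_int_class_on s I = {A. A \<subseteq> I \<and>
     (\<Union>k::int. (\<lambda>x. x + diameter I * of_int k) ` A) \<in> large_int_class s}"

end

theory Submission
  imports Defs "HOL-Real_Asymp.Real_Asymp"
begin

text \<open>
  Call \<open>G\<close> ubiquitous for \<open>t\<close> if at arbitrarily small scales \<open>d\<close> every interval of length \<open>d\<close> contains
  a closed interval of length \<open>C * d powr (1 / t)\<close> inside \<open>G\<close>. Because \<open>C\<close> is arbitrary, this is
  invariant under similarities. For countably many such sets, a homogeneous Cantor construction that
  treats one set per stage, at a scale far below that of the previous stage, gives a map \<open>\<phi>\<close> from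
  \<open>{0..<1}\<close> into the intersection whose inverse is \<open>t\<close>-Hoelder. Pulling a cover back along \<open>\<phi>\<close> to a
  cover of \<open>{0..<1}\<close> bounds the Hausdorff measure from below, without a Frostman measure on the limit
  set.

  For the beta transformation, every interval of length \<open>(n + 1) / \<beta> ^ n\<close> in \<open>{0..1}\<close> contains a full
  branch of the \<open>n\<close>-th iterate, and hence an interval of length \<open>\<beta> powr (- (1 + \<kappa>) * n)\<close> on which that
  iterate is at most \<open>\<beta> powr (- \<kappa> * n)\<close>. The witness is the limsup of the interiors of the level sets.
\<close>

section \<open>Ubiquitous sets under similarities\<close>

text \<open>The scale \<open>d\<close> is chosen before \<open>x\<close>: one scale serves the whole
  line, so all intervals of one Cantor stage can have the same length.\<close>

definition ubiquitous :: "real \<Rightarrow> real set \<Rightarrow> bool" where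
  "ubiquitous t G \<longleftrightarrow> (\<forall>C>0. \<forall>\<epsilon>>0. \<exists>d>0. d < \<epsilon> \<and>
     (\<forall>x. \<exists>y. {y..y + C * d powr (1 / t)} \<subseteq> {x..x + d} \<inter> G))"

text \<open>On the line a similarity of ratio \<open>c\<close> is affine with slope \<open>c\<close>
  or \<open>-c\<close>. It turns scale \<open>d\<close> into \<open>c * d\<close>, and the mismatch
  between \<open>c\<close> and \<open>c powr (1 / t)\<close> goes into the constant: the set
  \<open>G\<close> is used with \<open>C * c powr (1 / t) / c\<close> in place of
  \<open>C\<close>.\<close>

lemma ubiquitous_similarity:
  assumes f: "similarity f" and G: "ubiquitous t G" and t: "0 < t"
  shows "ubiquitous t (f ` G)"
proof -
  obtain c where c: "c > 0" and dist_f: "\<And>x y. dist (f x) (f y) = c * dist x y"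
    using f unfolding similarity_def by blast
  obtain \<sigma> where \<sigma>: "\<sigma> = 1 \<or> \<sigma> = -1" and f_eq: "\<And>x. f x = f 0 + \<sigma> * c * x"
  proof -
    define \<sigma> where "\<sigma> = (f 1 - f 0) / c"
    have s: "\<sigma> = 1 \<or> \<sigma> = -1"
      using dist_f[of 1 0] c by (auto simp: \<sigma>_def dist_real_def field_simps abs_if split: if_splits)
    have "f x = f 0 + \<sigma> * c * x" for x
    proof -
      have "\<bar>f x - f 0\<bar> = c * \<bar>x\<bar>" "\<bar>f x - f 1\<bar> = c * \<bar>x - 1\<bar>" 
        using dist_f[of x 0] dist_f[of x 1] by (auto simp: dist_real_def)
      then have "(f x - f 0)\<^sup>2 = (c * x)\<^sup>2" "(f x - f 1)\<^sup>2 = (c * (x - 1))\<^sup>2"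
        using c by (metis abs_mult abs_of_pos power2_abs)+
      moreover have "f 1 = f 0 + \<sigma> * c" using c by (simp add: \<sigma>_def)
      moreover have "\<sigma>\<^sup>2 = 1" using s by auto
      \<comment> \<open>Subtracting the two squared distance identities removes the quadratic terms
        and leaves an equation linear in \<open>f x\<close>.\<close>
      ultimately have "2 * (\<sigma> * c) * (f x - f 0) = 2 * c\<^sup>2 * x"
        by algebra
      then have "\<sigma> * (f x - f 0) = c * x" using c by (simp add: power2_eq_square)
      then have "f x - f 0 = \<sigma> * c * x" using s by auto
      then show ?thesis by simp
    qed
    then show ?thesis using that s by blast
  qed
  show ?thesis
    unfolding ubiquitous_def
  proof (intro allI impI)
    fix C \<epsilon> :: real assume C: "0 < C" and \<epsilon>: "0 < \<epsilon>"
    have "0 < C * c powr (1 / t) / c" "0 < \<epsilon> / c" using C c \<epsilon> by auto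
    then obtain d where d: "0 < d" "d < \<epsilon> / c"
      and sub: "\<And>x. \<exists>y. {y..y + C * c powr (1 / t) / c * d powr (1 / t)} \<subseteq> {x..x + d} \<inter> G"
      using G unfolding ubiquitous_def by meson
    define e where "e = C * c powr (1 / t) / c * d powr (1 / t)"
    have e: "C * (c * d) powr (1 / t) = c * e"
      using c d by (simp add: e_def powr_mult)
    have "\<exists>y. {y..y + c * e} \<subseteq> {x..x + c * d} \<inter> f ` G" for x
    proof (cases "\<sigma> = 1")
      case True
      obtain y where y: "{y..y + e} \<subseteq> {(x - f 0) / c..(x - f 0) / c + d} \<inter> G"
        using sub[of "(x - f 0) / c"] unfolding e_def by metis
      have "z \<in> {x..x + c * d} \<inter> f ` G" if "z \<in> {f y..f y + c * e}" for z
      proof -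
        define w where "w = (z - f 0) / c"
        have z: "z = f w" using f_eq[of w] True c by (simp add: w_def)
        have "c * y \<le> c * w" "c * w \<le> c * (y + e)"
          using that z f_eq[of y] f_eq[of w] True by (auto simp: algebra_simps)
        then have "w \<in> {y..y + e}" using c by simp
        then have "(x - f 0) / c \<le> w" "w \<le> (x - f 0) / c + d" "z \<in> f ` G" using y z by auto
        then show ?thesis using c z f_eq[of w] True by (auto simp: field_simps)
      qed
      then show ?thesis by blast
    next
      case False
      then have \<sigma>: "\<sigma> = -1" using \<sigma> by simp
      \<comment> \<open>An orientation-reversing \<open>f\<close> swaps endpoints, so the preimage
        of \<open>{x..x + c * d}\<close> starts at the preimage of the right endpoint.\<close>
      obtain y where y: "{y..y + e} \<subseteq> {(f 0 - x) / c - d..(f 0 - x) / c - d + d} \<inter> G"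
        using sub[of "(f 0 - x) / c - d"] unfolding e_def by metis
      have "z \<in> {x..x + c * d} \<inter> f ` G" if "z \<in> {f y - c * e..f y - c * e + c * e}" for z
      proof -
        define w where "w = (f 0 - z) / c"
        have z: "z = f w" using f_eq[of w] \<sigma> c by (simp add: w_def)
        have "c * y \<le> c * w" "c * w \<le> c * (y + e)"
          using that z f_eq[of y] f_eq[of w] \<sigma> by (auto simp: algebra_simps)
        then have "w \<in> {y..y + e}" using c by simp
        then have "(f 0 - x) / c - d \<le> w" "w \<le> (f 0 - x) / c" "z \<in> f ` G" using y z by auto
        then show ?thesis using c z f_eq[of w] \<sigma> by (auto simp: field_simps)
      qed
      then show ?thesis by blast
    qed
    then show "\<exists>d>0. d < \<epsilon> \<and> (\<forall>x. \<exists>y. {y..y + C * d powr (1 / t)} \<subseteq> {x..x + d} \<inter> f ` G)"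
      using d c by (intro exI[of _ "c * d"]) (auto simp: e field_simps)
  qed
qed

section \<open>The homogeneous Cantor construction\<close>

text \<open>One stage of the construction. A parent of length \<open>\<rho>\<close> holds
  \<open>p\<close> slots of length \<open>d\<close> with period \<open>2 * d\<close>, and each slot
  holds a child of length \<open>\<rho>'\<close> inside \<open>G\<close>. Child \<open>i\<close> has
  parent \<open>i div p\<close> and slot \<open>i mod p\<close>. With \<open>N\<close> parents, the
  bound by \<open>\<rho>' powr t\<close> says that the equal share of mass of a child is at most its
  length to the power \<open>t\<close>.\<close>

lemma ubiquitous_subdivision:
  fixes \<rho> t :: real and N :: nat and a :: "nat \<Rightarrow> real"
  assumes G: "ubiquitous t G" and t: "0 < t" and \<rho>: "0 < \<rho>" and N: "0 < N"
  obtains d \<rho>' :: real and p :: nat and a' :: "nat \<Rightarrow> real"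
  where "0 < d" "0 < \<rho>'" "2 \<le> p" "2 * real p * d \<le> \<rho>" "\<rho> \<le> 4 * real p * d"
    and "1 / real (N * p) \<le> \<rho>' powr t"
    and "\<And>i. {a' i..a' i + \<rho>'} \<subseteq>
          {a (i div p) + 2 * real (i mod p) * d..a (i div p) + 2 * real (i mod p) * d + d} \<inter> G"
proof -
  \<comment> \<open>This makes \<open>\<rho>' powr t\<close> equal to
    \<open>4 * d / (N * \<rho>)\<close>, which is at least \<open>1 / (N * p)\<close> because
    \<open>\<rho> \<le> 4 * p * d\<close>.\<close>
  define C where "C = (4 / (real N * \<rho>)) powr (1 / t)"
  have "0 < C" "0 < \<rho> / 4" using \<rho> N by (auto simp: C_def)
  then obtain d where d: "0 < d" "d < \<rho> / 4"
    and sub: "\<And>x. \<exists>y. {y..y + C * d powr (1 / t)} \<subseteq> {x..x + d} \<inter> G"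
    using G unfolding ubiquitous_def by meson
  obtain g where g: "\<And>x. {g x..g x + C * d powr (1 / t)} \<subseteq> {x..x + d} \<inter> G"
    using sub by metis
  \<comment> \<open>As \<open>d < \<rho> / 4\<close>, the quotient is at least 2, so rounding down
    loses at most a factor 2.\<close>
  define p where "p = nat \<lfloor>\<rho> / (2 * d)\<rfloor>"
  have big: "2 \<le> \<rho> / (2 * d)" using d by (simp add: field_simps)
  then have p2: "2 \<le> p" unfolding p_def by (simp add: le_nat_floor)
  have "0 \<le> \<rho> / (2 * d)" using big by linarith
  then have p: "real p \<le> \<rho> / (2 * d)" "\<rho> / (2 * d) < real p + 1"
    unfolding p_def by linarith+
  have "\<rho> / (2 * d) \<le> 2 * real p" using p p2 by linarith
  then have rp: "2 * real p * d \<le> \<rho>" "\<rho> \<le> 4 * real p * d"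
    using p d by (auto simp: field_simps)
  define \<rho>' where "\<rho>' = C * d powr (1 / t)"
  have "\<rho>' powr t = 4 / (real N * \<rho>) * d"
    using \<rho> N d t by (simp add: \<rho>'_def C_def powr_mult powr_powr)
  moreover have "1 / real (N * p) \<le> 4 / (real N * \<rho>) * d"
    using rp \<rho> N p2 by (simp add: field_simps)
  ultimately have "1 / real (N * p) \<le> \<rho>' powr t" by simp
  moreover have "0 < \<rho>'" using \<open>0 < C\<close> d by (simp add: \<rho>'_def)
  ultimately show ?thesis
    using that[of d \<rho>' p "\<lambda>i. g (a (i div p) + 2 * real (i mod p) * d)"] d p2 rp g
    by (simp add: \<rho>'_def)
qed

text \<open>Here \<open>w\<close> is a distance of parameters and \<open>l\<close> the distance of
  their images. If \<open>l\<close> is at least the parent length \<open>\<rho>\<close>, the mass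
  bound alone suffices. Otherwise \<open>w\<close> is at most \<open>8 * l / \<rho>\<close> times
  the mass \<open>1 / N\<close>, and \<open>t \<le> 1\<close> gives
  \<open>\<rho> powr (t - 1) \<le> l powr (t - 1)\<close>. The 8 is the 4 of the bound on
  \<open>\<rho>\<close> times the 2 of the bound on \<open>w\<close>.\<close>

lemma powr_le_of_scales:
  fixes N p q d \<rho> l t w :: real
  assumes t: "0 < t" "t \<le> 1" and pos: "0 < N" "0 < p" "0 < d" "0 < \<rho>" "0 < l" "0 \<le> w"
    and N: "1 / N \<le> \<rho> powr t" and p: "\<rho> \<le> 4 * p * d"
    and w: "w \<le> 1 / N" "w * (N * p) \<le> 2 * q" and q: "q * d \<le> l"
  shows "w \<le> 8 * l powr t"
proof (cases "\<rho> \<le> l")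
  case True
  have "w \<le> \<rho> powr t" using w(1) N by linarith
  also have "\<dots> \<le> l powr t" using True pos t by (intro powr_mono2) auto
  finally show ?thesis using powr_ge_zero[of l t] by linarith
next
  case False
  have "w * (N * p) * d \<le> 2 * q * d" using w(2) pos by (intro mult_right_mono) auto
  also have "\<dots> \<le> 2 * l" using q by simp
  finally have "w * N * (4 * p * d) \<le> 8 * l" by (simp add: algebra_simps)
  moreover have "w * N * \<rho> \<le> w * N * (4 * p * d)" using p pos by (intro mult_left_mono) auto
  ultimately have "w * N * \<rho> \<le> 8 * l" by linarith
  then have "w \<le> 8 * l / \<rho> * (1 / N)" using pos by (simp add: field_simps)
  also have "\<dots> \<le> 8 * l / \<rho> * \<rho> powr t" using N pos by (intro mult_left_mono) auto
  also have "\<dots> = 8 * l * \<rho> powr (t - 1)" using pos by (simp add: powr_diff)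
  also have "\<dots> \<le> 8 * l * l powr (t - 1)"
    using False pos t by (intro mult_left_mono powr_mono2') auto
  also have "\<dots> = 8 * l powr t" using pos by (simp add: powr_diff)
  finally show ?thesis .
qed

text \<open>Ensures that the interval assigned to a parameter at one stage is a child of the one
  assigned at the stage before.\<close>

lemma nat_floor_mult_div:
  fixes x :: real
  assumes "0 \<le> x" "0 < p"
  shows "nat \<lfloor>x * real p\<rfloor> div p = nat \<lfloor>x\<rfloor>"
proof -
  have "\<lfloor>x * real p / real_of_int (int p)\<rfloor> = \<lfloor>x * real p\<rfloor> div int p"
    by (rule floor_divide_real_eq_div) simp
  then show ?thesis using assms by (simp add: nat_div_distrib)
qed

text \<open>At stage \<open>k\<close> the parameter \<open>u\<close> selects the interval number
  \<open>\<lfloor>u * N k\<rfloor>\<close>; \<open>\<phi> u\<close> is a point common to these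
  nested intervals. The distance of two images is estimated at the first stage that tells their
  parameters apart.\<close>

lemma ubiquitous_Inter_expanding:
  fixes G :: "nat \<Rightarrow> real set"
  assumes G: "\<And>k. ubiquitous t (G k)" and t: "0 < t" "t \<le> 1"
  obtains \<phi> :: "real \<Rightarrow> real"
  where "\<And>u. u \<in> {0..<1} \<Longrightarrow> \<phi> u \<in> (\<Inter>k. G k)"
    and "\<And>u v. u \<in> {0..<1} \<Longrightarrow> v \<in> {0..<1} \<Longrightarrow> \<bar>u - v\<bar> \<le> 8 * \<bar>\<phi> u - \<phi> v\<bar> powr t"
proof -
  \<comment> \<open>A state consists of the number of intervals, their common length and their left
    endpoints. Requiring \<open>N = 1\<close> at stage 0 gives all parameters a common
    ancestor.\<close>
  define P :: "nat \<Rightarrow> nat \<times> real \<times> (nat \<Rightarrow> real) \<Rightarrow> bool" where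
    "P k s \<longleftrightarrow> (case s of (N, \<rho>, a) \<Rightarrow>
       0 < N \<and> 0 < \<rho> \<and> 1 / real N \<le> \<rho> powr t \<and> (k = 0 \<longrightarrow> N = 1))" for k s
  define Q :: "nat \<Rightarrow> nat \<times> real \<times> (nat \<Rightarrow> real) \<Rightarrow> nat \<times> real \<times> (nat \<Rightarrow> real) \<Rightarrow> bool" where
    "Q k s s' \<longleftrightarrow> (case (s, s') of ((N, \<rho>, a), (N', \<rho>', a')) \<Rightarrow> \<exists>p d. 2 \<le> p \<and> 0 < d \<and> N' = N * p \<and>
       2 * real p * d \<le> \<rho> \<and> \<rho> \<le> 4 * real p * d \<and>
       (\<forall>i. {a' i..a' i + \<rho>'} \<subseteq>
          {a (i div p) + 2 * real (i mod p) * d..a (i div p) + 2 * real (i mod p) * d + d} \<inter> G k))"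
    for k s s'
  have "\<exists>s. \<forall>k. P k (s k) \<and> Q k (s k) (s (Suc k))"
  proof (rule dependent_nat_choice)
    show "\<exists>s. P 0 s" by (rule exI[of _ "(1, 1, \<lambda>_. 0)"]) (simp add: P_def)
    fix s k assume "P k s"
    then obtain N \<rho> a where s: "s = (N, \<rho>, a)" and *: "0 < N" "0 < \<rho>"
      by (cases s) (auto simp: P_def)
    obtain d \<rho>' p a' where sd: "0 < d" "0 < \<rho>'" "2 \<le> p" "2 * real p * d \<le> \<rho>" "\<rho> \<le> 4 * real p * d"
      "1 / real (N * p) \<le> \<rho>' powr t"
      "\<And>i. {a' i..a' i + \<rho>'} \<subseteq>
          {a (i div p) + 2 * real (i mod p) * d..a (i div p) + 2 * real (i mod p) * d + d} \<inter> G k"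
      using ubiquitous_subdivision[OF G[of k] t(1) *(2,1), where a = a] by blast
    have "P (Suc k) (N * p, \<rho>', a')" using sd * by (simp add: P_def)
    moreover have "Q k s (N * p, \<rho>', a')" unfolding Q_def s using sd by fastforce
    ultimately show "\<exists>s'. P (Suc k) s' \<and> Q k s s'" by blast
  qed
  then obtain s where s: "\<And>k. P k (s k)" "\<And>k. Q k (s k) (s (Suc k))" by blast
  define N \<rho> a where "N k = fst (s k)" and "\<rho> k = fst (snd (s k))" and "a k = snd (snd (s k))" for k
  have s_eq: "s k = (N k, \<rho> k, a k)" for k by (simp add: N_def \<rho>_def a_def)
  have pos: "0 < N k" "0 < \<rho> k" and mass: "1 / real (N k) \<le> \<rho> k powr t" and N0: "N 0 = 1" for k
    using s(1)[of k] s(1)[of 0] by (auto simp: P_def s_eq)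
  have "\<exists>p d. 2 \<le> p \<and> 0 < d \<and> N (Suc k) = N k * p \<and> 2 * real p * d \<le> \<rho> k \<and> \<rho> k \<le> 4 * real p * d \<and>
       (\<forall>i. {a (Suc k) i..a (Suc k) i + \<rho> (Suc k)} \<subseteq>
          {a k (i div p) + 2 * real (i mod p) * d..a k (i div p) + 2 * real (i mod p) * d + d} \<inter> G k)"
    for k using s(2)[of k] by (simp add: Q_def s_eq)
  then obtain p d where p: "\<And>k. 2 \<le> p k" and d: "\<And>k. 0 < d k" and N_Suc: "\<And>k. N (Suc k) = N k * p k"
    and pd: "\<And>k. 2 * real (p k) * d k \<le> \<rho> k" "\<And>k. \<rho> k \<le> 4 * real (p k) * d k"
    and child: "\<And>k i. {a (Suc k) i..a (Suc k) i + \<rho> (Suc k)} \<subseteq>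
       {a k (i div p k) + 2 * real (i mod p k) * d k..a k (i div p k) + 2 * real (i mod p k) * d k + d k} \<inter> G k"
    by metis
  define idx where "idx k u = nat \<lfloor>u * real (N k)\<rfloor>" for k u
  define I where "I k u = {a k (idx k u)..a k (idx k u) + \<rho> k}" for k u
  have idx_Suc: "idx (Suc k) u div p k = idx k u" if "0 \<le> u" for k u
    unfolding idx_def N_Suc of_nat_mult mult.assoc[symmetric]
    using that p[of k] by (intro nat_floor_mult_div) auto
  have I_Suc: "I (Suc k) u \<subseteq> I k u \<inter> G k" if "0 \<le> u" for k u
  proof -
    have "idx (Suc k) u mod p k < p k" using p[of k] by simp
    then have "real (idx (Suc k) u mod p k) + 1 \<le> real (p k)" by linarith
    then have "2 * (real (idx (Suc k) u mod p k) + 1) * d k \<le> 2 * real (p k) * d k"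
      using d[of k] by simp
    then have upper: "2 * real (idx (Suc k) u mod p k) * d k + d k \<le> \<rho> k"
      using pd(1)[of k] d[of k] unfolding distrib_left distrib_right by linarith
    have "0 \<le> 2 * real (idx (Suc k) u mod p k) * d k" using d[of k] by simp
    then have "{a k (idx k u) + 2 * real (idx (Suc k) u mod p k) * d k..
        a k (idx k u) + 2 * real (idx (Suc k) u mod p k) * d k + d k} \<subseteq> I k u"
      unfolding I_def atLeastatMost_subset_iff using upper by linarith
    then show ?thesis
      using child[of k "idx (Suc k) u"] unfolding idx_Suc[OF that] I_def[of "Suc k"] by blast
  qed
  have "\<exists>x. \<forall>k. x \<in> I k u" if "0 \<le> u" for u
  proof -
    have "(\<Inter>k. I k u) \<noteq> {}"
    proof (rule compact_nest)
      show "compact (I k u)" "I k u \<noteq> {}" for k using pos(2)[of k] by (auto simp: I_def)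
      show "I n u \<subseteq> I m u" if "m \<le> n" for m n
        by (rule lift_Suc_antimono_le[of "\<lambda>k. I k u", OF _ that]) (use I_Suc[OF \<open>0 \<le> u\<close>] in blast)
    qed
    then show ?thesis by blast
  qed
  then obtain \<phi> where \<phi>: "\<And>u k. 0 \<le> u \<Longrightarrow> \<phi> u \<in> I k u" by metis
  have expanding: "v - u \<le> 8 * \<bar>\<phi> v - \<phi> u\<bar> powr t" if uv: "0 \<le> u" "u < v" "v < 1" for u v
  proof -
    \<comment> \<open>The number of intervals at least doubles per stage, so distinct parameters are
      eventually told apart.\<close>
    have pow: "(2::real) ^ k \<le> real (N k)" for k
    proof (induction k)
      case (Suc k)
      then show ?case using mult_mono[of "2 ^ k" "real (N k)" 2 "real (p k)"] p[of k]
        by (simp add: N_Suc mult.commute)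
    qed (simp add: N0)
    have fl: "real (idx n u) \<le> u * real (N n)" "u * real (N n) < real (idx n u) + 1"
       "real (idx n v) \<le> v * real (N n)" "v * real (N n) < real (idx n v) + 1" for n
      using uv by (auto simp: idx_def)
    obtain n where n: "1 / (v - u) < 2 ^ n" using real_arch_pow[of 2] by auto
    have "1 / (v - u) < real (N n)" using n pow[of n] by linarith
    then have "1 < v * real (N n) - u * real (N n)" using uv by (simp add: field_simps)
    then have ne: "idx n u \<noteq> idx n v" using fl(1,4)[of n] by auto
    define m where "m = (LEAST n. idx n u \<noteq> idx n v)"
    have m: "idx m u \<noteq> idx m v" unfolding m_def using ne by (rule LeastI)
    have least: "idx k u = idx k v" if "k < m" for k
      using not_less_Least[of k "\<lambda>n. idx n u \<noteq> idx n v"] that unfolding m_def by blast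
    have "idx 0 u = idx 0 v" using uv by (simp add: idx_def N0 floor_eq_iff)
    then obtain k where k: "m = Suc k" using m by (cases m) auto
    have same: "idx k u = idx k v" using least k by simp
    define i j where "i = idx m u mod p k" and "j = idx m v mod p k"
    have idx_m: "idx m u = idx k u * p k + i" "idx m v = idx k u * p k + j"
      using idx_Suc[of u k] idx_Suc[of v k] uv same unfolding i_def j_def k
      by (metis div_mult_mod_eq less_imp_le order_trans)+
    have "u * real (N m) \<le> v * real (N m)" using uv by (intro mult_right_mono) auto
    then have "real (idx m u) < real (idx m v) + 1" using fl[of m] by linarith
    then have ij: "i < j" using m idx_m by auto
    \<comment> \<open>Slots \<open>q\<close> steps apart leave a gap of
      \<open>(2 * q - 1) * d k\<close>, which is at least \<open>q * d k\<close>; the period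
      \<open>2 * d k\<close> keeps even neighbours apart.\<close>
    define q where "q = real j - real i"
    have q: "1 \<le> q" using ij by (simp add: q_def)
    have "\<phi> u \<le> a k (idx k u) + 2 * real i * d k + d k" "a k (idx k u) + 2 * real j * d k \<le> \<phi> v"
      using child[of k "idx m u"] child[of k "idx m v"] \<phi>[of u m] \<phi>[of v m] idx_Suc[of u k] idx_Suc[of v k] uv same
      unfolding I_def k i_def j_def by (auto simp: subset_iff)
    then have "2 * q * d k - d k \<le> \<phi> v - \<phi> u" by (simp add: q_def algebra_simps)
    moreover have "d k \<le> q * d k" using q d[of k] by simp
    ultimately have l: "q * d k \<le> \<phi> v - \<phi> u" "0 < \<phi> v - \<phi> u" using d[of k] by linarith+
    \<comment> \<open>A common index at stage \<open>k\<close> bounds \<open>v - u\<close> by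
      \<open>1 / N k\<close>; indices \<open>q\<close> apart at stage \<open>m\<close> bound it by
      \<open>(q + 1) / N m\<close>, and \<open>q + 1 \<le> 2 * q\<close>.\<close>
    have "(v - u) * real (N k) < 1" using fl[of k] same by (simp add: algebra_simps)
    then have w1: "v - u \<le> 1 / real (N k)" using pos(1)[of k] by (simp add: field_simps)
    have "(v - u) * real (N m) < q + 1"
      using fl(1,4)[of m] unfolding idx_m q_def by (simp add: algebra_simps)
    then have w2: "(v - u) * (real (N k) * real (p k)) \<le> 2 * q" using q by (simp add: k N_Suc)
    have "v - u \<le> 8 * (\<phi> v - \<phi> u) powr t"
      using p[of k] uv pos
      by (intro powr_le_of_scales[OF t _ _ d[of k] pos(2)[of k] l(2) _ mass[of k] pd(2)[of k] w1 w2 l(1)]) auto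
    then show ?thesis using l(2) by simp
  qed
  show ?thesis
  proof (rule that)
    show "\<phi> u \<in> (\<Inter>k. G k)" if "u \<in> {0..<1}" for u
      using \<phi>[of u "Suc _"] I_Suc[of u] that by fastforce
    show "\<bar>u - v\<bar> \<le> 8 * \<bar>\<phi> u - \<phi> v\<bar> powr t" if "u \<in> {0..<1}" "v \<in> {0..<1}" for u v
      using expanding[of u v] expanding[of v u] that t
      by (cases u v rule: linorder_cases) (auto simp: abs_minus_commute)
  qed
qed

section \<open>Lower bounds for Hausdorff measure and dimension\<close>

text \<open>The preimage of a covering set lies in a closed interval of length proportional to its
  gauge. These intervals cover \<open>{0..<1}\<close>, so countable subadditivity of Lebesgue
  measure bounds the sum of the gauges from below.\<close>

lemma hausdorff_measure_pos_of_expanding: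
  fixes \<phi> :: "real \<Rightarrow> 'a::metric_space"
  assumes s: "0 \<le> s" and c: "0 \<le> c"
    and X: "\<And>u. u \<in> {0..<1} \<Longrightarrow> \<phi> u \<in> X"
    and expanding: "\<And>u v. u \<in> {0..<1} \<Longrightarrow> v \<in> {0..<1} \<Longrightarrow> \<bar>u - v\<bar> \<le> c * dist (\<phi> u) (\<phi> v) powr s"
  shows "hausdorff_measure s X \<noteq> 0"
proof -
  \<comment> \<open>The summand \<open>1\<close> makes \<open>b\<close> positive and absorbs the case \<open>s = 0\<close>, where the gauge is \<open>1\<close>.\<close>
  define b where "b = 2 * (c + 1)"
  have b: "0 < b" using c by (simp add: b_def)
  have "ennreal (1 / b) \<le> (\<Sum>i. hausdorff_gauge s (U i))" if U: "delta_cover 1 X U" for U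
  proof -
    have "\<exists>w r. {0..<1} \<inter> \<phi> -` U i \<subseteq> {w - (c + 1) * r..w + (c + 1) * r} \<and>
        0 \<le> r \<and> hausdorff_gauge s (U i) = ennreal r" for i
    proof (cases "{0..<1} \<inter> \<phi> -` U i = {}")
      case True
      then show ?thesis
        by (intro exI[of _ 0] exI[of _ "if U i = {} then 0 else if s = 0 then 1 else diameter (U i) powr s"])
          (auto simp: hausdorff_gauge_def)
    next
      case False
      then obtain w where w: "w \<in> {0..<1}" "\<phi> w \<in> U i" by blast
      define r where "r = (if s = 0 then 1 else diameter (U i) powr s)"
      have gauge: "hausdorff_gauge s (U i) = ennreal r" using w by (auto simp: hausdorff_gauge_def r_def)
      have r: "0 \<le> r" by (simp add: r_def)
      have "\<bar>u - w\<bar> \<le> (c + 1) * r" if u: "u \<in> {0..<1}" "\<phi> u \<in> U i" for u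
      proof (cases "s = 0")
        case True
        then show ?thesis using u w c by (auto simp: r_def)
      next
        case False
        have "dist (\<phi> u) (\<phi> w) \<le> diameter (U i)"
          using U u w by (intro diameter_bounded_bound) (auto simp: delta_cover_def)
        then have "dist (\<phi> u) (\<phi> w) powr s \<le> r"
          using s False by (auto simp: r_def intro: powr_mono2)
        then have "c * dist (\<phi> u) (\<phi> w) powr s \<le> c * r" using c by (rule mult_left_mono)
        then show ?thesis using expanding[OF u(1) w(1)] r by (simp add: distrib_right)
      qed
      then have "{0..<1} \<inter> \<phi> -` U i \<subseteq> {w - (c + 1) * r..w + (c + 1) * r}"
        by (fastforce simp: abs_le_iff)
      then show ?thesis using r gauge by blast
    qed
    then obtain w r where sub: "\<And>i. {0..<1} \<inter> \<phi> -` U i \<subseteq> {w i - (c + 1) * r i..w i + (c + 1) * r i}"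
      and r: "\<And>i. 0 \<le> r i" and gauge: "\<And>i. hausdorff_gauge s (U i) = ennreal (r i)" by metis
    define J where "J i = {w i - (c + 1) * r i..w i + (c + 1) * r i}" for i
    have cover: "{0..<1} \<subseteq> (\<Union>i. J i)"
    proof
      fix u :: real assume u: "u \<in> {0..<1}"
      then have "\<phi> u \<in> (\<Union>i. U i)" using X[of u] U unfolding delta_cover_def by blast
      then obtain i where "\<phi> u \<in> U i" by blast
      then show "u \<in> (\<Union>i. J i)" using sub[of i] u unfolding J_def by blast
    qed
    have J: "emeasure lborel (J i) = ennreal b * hausdorff_gauge s (U i)" for i
    proof -
      have "emeasure lborel (J i) = ennreal (b * r i)"
        using r[of i] c by (simp add: J_def b_def algebra_simps)
      then show ?thesis using b r[of i] by (simp add: gauge ennreal_mult)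
    qed
    have "1 = emeasure lborel {0..<1::real}" by simp
    also have "\<dots> \<le> emeasure lborel (\<Union>i. J i)" by (intro emeasure_mono cover) (auto simp: J_def)
    also have "\<dots> \<le> (\<Sum>i. emeasure lborel (J i))"
      by (rule emeasure_subadditive_countably) (auto simp: J_def)
    finally have "1 \<le> ennreal b * (\<Sum>i. hausdorff_gauge s (U i))" by (simp add: J)
    then have "ennreal (1 / b) * 1 \<le> ennreal (1 / b) * (ennreal b * (\<Sum>i. hausdorff_gauge s (U i)))"
      by (intro mult_left_mono) auto
    also have "\<dots> = (\<Sum>i. hausdorff_gauge s (U i))"
      using b by (simp add: mult.assoc[symmetric] ennreal_mult[symmetric])
    finally show ?thesis by simp
  qed
  \<comment> \<open>The measure is a supremum over \<open>\<delta>\<close>, so the bound at the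
    single scale 1 suffices.\<close>
  then have "ennreal (1 / b) \<le> (INF U\<in>Collect (delta_cover 1 X). \<Sum>i. hausdorff_gauge s (U i))"
    by (intro INF_greatest) auto
  also have "\<dots> \<le> hausdorff_measure s X"
    unfolding hausdorff_measure_def by (rule SUP_upper) simp
  finally show ?thesis using b by (auto simp: ennreal_eq_0_iff)
qed

text \<open>The dimension is an infimum over exponents of measure zero, so it is enough to exclude
  every \<open>r < s\<close>. This is why ubiquity is asked only for \<open>t < s\<close>.\<close>

lemma hausdorff_dim_ge_of_ubiquitous:
  assumes F: "countable F" "F \<noteq> {}" "\<Inter>F \<subseteq> X"
    and ub: "\<And>G t. G \<in> F \<Longrightarrow> 0 < t \<Longrightarrow> t < s \<Longrightarrow> ubiquitous t G"
    and s: "0 < s" "s \<le> 1"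
  shows "ereal s \<le> hausdorff_dim X"
proof -
  have "hausdorff_measure r X \<noteq> 0" if r: "0 \<le> r" "r < s" for r
  proof -
    \<comment> \<open>The construction requires a positive exponent, so \<open>r = 0\<close> is
      served by \<open>s / 2\<close>.\<close>
    define t where "t = (if r = 0 then s / 2 else r)"
    have t: "0 < t" "t < s" "t \<le> 1" using r s by (auto simp: t_def)
    have "ubiquitous t (from_nat_into F k)" for k
      using ub[OF from_nat_into[OF F(2)] t(1,2)] .
    then obtain \<phi> :: "real \<Rightarrow> real" where \<phi>: "\<And>u. u \<in> {0..<1} \<Longrightarrow> \<phi> u \<in> (\<Inter>k. from_nat_into F k)"
      and exp: "\<And>u v. u \<in> {0..<1} \<Longrightarrow> v \<in> {0..<1} \<Longrightarrow> \<bar>u - v\<bar> \<le> 8 * \<bar>\<phi> u - \<phi> v\<bar> powr t"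
      using ubiquitous_Inter_expanding[OF _ t(1,3)] by blast
    have X: "\<phi> u \<in> X" if "u \<in> {0..<1}" for u
      using \<phi>[OF that] F range_from_nat_into[OF F(2,1)] by auto
    have "\<bar>u - v\<bar> \<le> 8 * dist (\<phi> u) (\<phi> v) powr r" if "u \<in> {0..<1}" "v \<in> {0..<1}" for u v
    proof (cases "r = 0")
      case True
      \<comment> \<open>Since \<open>0 powr 0 = 0\<close>, equal images need an argument: there the
        estimate with exponent \<open>t\<close> forces \<open>u = v\<close>.\<close>
      then show ?thesis using exp[OF that] that by (cases "\<phi> u = \<phi> v") auto
    next
      case False
      then show ?thesis using exp[OF that] by (simp add: t_def dist_real_def)
    qed
    then show ?thesis
      using hausdorff_measure_pos_of_expanding[of r 8 \<phi> X] r(1) X by auto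
  qed
  then show ?thesis
    unfolding hausdorff_dim_def by (intro Inf_greatest) force
qed

section \<open>Full branches of the iterates\<close>

lemma beta_map_full_branch:
  fixes \<beta> x :: real
  assumes \<beta>: "1 < \<beta>" "\<beta> \<le> 2"
    and x: "0 \<le> x" "x + (real n + 1) / \<beta> ^ n \<le> 1"
  shows "\<exists>y. x \<le> y \<and> y + 1 / \<beta> ^ n \<le> x + (real n + 1) / \<beta> ^ n \<and>
             (\<forall>z. 0 \<le> z \<longrightarrow> z < 1 / \<beta> ^ n \<longrightarrow> (beta_map \<beta> ^^ n) (y + z) = \<beta> ^ n * z)"
  using x
  \<comment> \<open>If the image of the interval crosses the discontinuity and its right part is too short for a full
     branch, discarding that part costs exactly one unit of the factor \<open>n + 1\<close>.\<close>
proof (induction n arbitrary: x)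
  case 0
  then show ?case by (intro exI[of _ x]) auto
next
  case (Suc n)
  define D where "D = (real n + 2) / \<beta> ^ Suc n"
  define r where "r = 1 / \<beta> ^ n"
  have D: "(real (Suc n) + 1) / \<beta> ^ Suc n = D" "\<beta> * D = (real n + 2) * r"
    and r: "1 / \<beta> ^ Suc n = r / \<beta>" "(real n + 1) / \<beta> ^ n = (real n + 1) * r" "1 / \<beta> ^ n = r" "0 < r"
    using \<beta> by (auto simp: D_def r_def)
  have x: "0 \<le> x" "x + D \<le> 1" using Suc.prems unfolding D(1) by auto
  note IH = Suc.IH[unfolded r]
  \<comment> \<open>Pulls a full branch of the \<open>n\<close>-th iterate back through the inverse
    branch \<open>v \<mapsto> (c + v) / \<beta>\<close> of one step.\<close>
  have branch: "\<exists>y. x \<le> y \<and> y + r / \<beta> \<le> x + D \<and>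
      (\<forall>z. 0 \<le> z \<longrightarrow> z < r / \<beta> \<longrightarrow> (beta_map \<beta> ^^ Suc n) (y + z) = \<beta> ^ Suc n * z)"
    if y: "\<beta> * x \<le> c + w" "c + w + r \<le> \<beta> * (x + D)" and c: "c \<in> \<int>" and w: "0 \<le> w" "w + r \<le> 1"
      and lin: "\<forall>z. 0 \<le> z \<longrightarrow> z < r \<longrightarrow> (beta_map \<beta> ^^ n) (w + z) = \<beta> ^ n * z"
    for c w
  proof (intro exI[of _ "(c + w) / \<beta>"] conjI allI impI)
    show "x \<le> (c + w) / \<beta>" "(c + w) / \<beta> + r / \<beta> \<le> x + D"
      using y \<beta> by (simp_all add: field_simps)
    fix z assume z: "0 \<le> z" "z < r / \<beta>"
    then have bz: "0 \<le> \<beta> * z" "\<beta> * z < r" using \<beta> by (auto simp: field_simps)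
    have "\<beta> * ((c + w) / \<beta> + z) - (w + \<beta> * z) = c"
      using \<beta> by (simp add: distrib_left[of \<beta> "(c + w) / \<beta>" z])
    then have "\<beta> * ((c + w) / \<beta> + z) - (w + \<beta> * z) \<in> \<int>" using c by metis
    then have "beta_map \<beta> ((c + w) / \<beta> + z) = w + \<beta> * z"
      unfolding beta_map_def frac_unique_iff using w bz by linarith
    then show "(beta_map \<beta> ^^ Suc n) ((c + w) / \<beta> + z) = \<beta> ^ Suc n * z"
      using lin bz by (simp add: funpow_Suc_right del: funpow.simps)
  qed
  have shrink: "0 \<le> (real n + 1) * r" "(real n + 1) * r \<le> \<beta> * D" "(real n + 1) * r + r = \<beta> * D"
  proof -
    show "(real n + 1) * r + r = \<beta> * D" unfolding D(2) by (simp add: algebra_simps)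
    then show "(real n + 1) * r \<le> \<beta> * D" using r(4) by linarith
    show "0 \<le> (real n + 1) * r" using r(4) by simp
  qed
  \<comment> \<open>Here \<open>\<beta> \<le> 2\<close> enters: the image of the interval lies in
    \<open>{0..2}\<close>, so 1 is the only integer that can split it.\<close>
  have bound: "\<beta> * (x + D) \<le> 2" using x \<beta> mult_mono[of \<beta> 2 "x + D" 1] by (simp add: D_def)
  consider (right) "1 \<le> \<beta> * x" | (left) "\<beta> * x + (real n + 1) * r \<le> 1"
    | (straddle) "\<beta> * x < 1" "1 < \<beta> * x + (real n + 1) * r" by linarith
  then show ?case
    unfolding D(1) r(1)
  proof cases
    case right
    have p: "0 \<le> \<beta> * x - 1" "\<beta> * x - 1 + (real n + 1) * r \<le> 1"
      using right bound shrink(2) unfolding distrib_left[of \<beta> x D] by linarith+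
    obtain w where w: "\<beta> * x - 1 \<le> w" "w + r \<le> \<beta> * x - 1 + (real n + 1) * r"
      "\<forall>z. 0 \<le> z \<longrightarrow> z < r \<longrightarrow> (beta_map \<beta> ^^ n) (w + z) = \<beta> ^ n * z"
      using IH[OF p] by blast
    show "\<exists>y. x \<le> y \<and> y + r / \<beta> \<le> x + D \<and>
      (\<forall>z. 0 \<le> z \<longrightarrow> z < r / \<beta> \<longrightarrow> (beta_map \<beta> ^^ Suc n) (y + z) = \<beta> ^ Suc n * z)"
    proof (rule branch[of 1 w])
      show "\<beta> * x \<le> 1 + w" using w(1) by linarith
      show "1 + w + r \<le> \<beta> * (x + D)" using w(2) shrink(2) unfolding distrib_left[of \<beta> x D] by linarith
      show "0 \<le> w" "w + r \<le> 1" using p w by linarith+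
    qed (use w in auto)
  next
    case left
    have p: "0 \<le> \<beta> * x" using x \<beta> by simp
    obtain w where w: "\<beta> * x \<le> w" "w + r \<le> \<beta> * x + (real n + 1) * r"
      "\<forall>z. 0 \<le> z \<longrightarrow> z < r \<longrightarrow> (beta_map \<beta> ^^ n) (w + z) = \<beta> ^ n * z"
      using IH[OF p left] by blast
    show "\<exists>y. x \<le> y \<and> y + r / \<beta> \<le> x + D \<and>
      (\<forall>z. 0 \<le> z \<longrightarrow> z < r / \<beta> \<longrightarrow> (beta_map \<beta> ^^ Suc n) (y + z) = \<beta> ^ Suc n * z)"
    proof (rule branch[of 0 w])
      show "\<beta> * x \<le> 0 + w" using w(1) by linarith
      show "0 + w + r \<le> \<beta> * (x + D)" using w(2) shrink(2) unfolding distrib_left[of \<beta> x D] by linarith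
      show "0 \<le> w" "w + r \<le> 1" using p left w by linarith+
    qed (use w in auto)
  next
    case straddle
    have r1: "r \<le> 1" using \<beta> by (simp add: r_def)
    \<comment> \<open>An orbit starting in \<open>[0, r)\<close> does not wrap around during
      \<open>n\<close> steps, so a full branch begins right at the discontinuity.\<close>
    have lin: "\<forall>z. 0 \<le> z \<longrightarrow> z < r \<longrightarrow> (beta_map \<beta> ^^ n) (0 + z) = \<beta> ^ n * z"
    proof -
      have "(beta_map \<beta> ^^ m) z = \<beta> ^ m * z" if "m \<le> n" "0 \<le> z" "z < r" for m z
        using that(1)
      proof (induction m)
        case (Suc m)
        have "\<beta> ^ Suc m * z < \<beta> ^ Suc m * r" using that \<beta> by (intro mult_strict_left_mono) auto
        also have "\<dots> \<le> \<beta> ^ n * r" using Suc.prems \<beta> r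
          by (intro mult_right_mono power_increasing) auto
        also have "\<dots> = 1" using \<beta> by (simp add: r_def)
        finally have "frac (\<beta> ^ Suc m * z) = \<beta> ^ Suc m * z"
          unfolding frac_eq using that(2) \<beta> by simp
        moreover have "(beta_map \<beta> ^^ m) z = \<beta> ^ m * z" using Suc by simp
        ultimately show ?case by (simp add: beta_map_def[of \<beta> "\<beta> ^ m * z"] mult.assoc)
      qed simp
      then show ?thesis by auto
    qed
    show "\<exists>y. x \<le> y \<and> y + r / \<beta> \<le> x + D \<and>
      (\<forall>z. 0 \<le> z \<longrightarrow> z < r / \<beta> \<longrightarrow> (beta_map \<beta> ^^ Suc n) (y + z) = \<beta> ^ Suc n * z)"
    proof (rule branch[of 1 0])
      show "\<beta> * x \<le> 1 + 0" using straddle by linarith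
      \<comment> \<open>The part of the image left of 1 is shorter than \<open>(n + 1) * r\<close>,
        so more than \<open>r\<close> remains to the right.\<close>
      show "1 + 0 + r \<le> \<beta> * (x + D)" using straddle shrink(3) unfolding distrib_left[of \<beta> x D] by linarith
    qed (use r1 lin in auto)
  qed
qed

section \<open>Countable exceptional sets\<close>

text \<open>Every preimage of \<open>c\<close> under one step has the form
  \<open>(c + m) / \<beta>\<close> with an integer \<open>m\<close>.\<close>

lemma countable_beta_map_vimage:
  assumes "\<beta> \<noteq> 0" "countable C"
  shows "countable ((beta_map \<beta> ^^ n) -` C)"
proof (induction n)
  case 0
  then show ?case using assms by simp
next
  case (Suc n)
  have vimage: "beta_map \<beta> -` E \<subseteq> (\<Union>m::int. (\<lambda>c. (c + of_int m) / \<beta>) ` E)" for E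
  proof
    fix x assume "x \<in> beta_map \<beta> -` E"
    moreover have "x = (beta_map \<beta> x + of_int \<lfloor>\<beta> * x\<rfloor>) / \<beta>"
      using assms by (simp add: beta_map_def frac_def)
    ultimately show "x \<in> (\<Union>m::int. (\<lambda>c. (c + of_int m) / \<beta>) ` E)" by blast
  qed
  have "countable (beta_map \<beta> -` ((beta_map \<beta> ^^ n) -` C))"
    using Suc by (intro countable_subset[OF vimage]) auto
  moreover have "(beta_map \<beta> ^^ Suc n) -` C = beta_map \<beta> -` ((beta_map \<beta> ^^ n) -` C)"
    by (simp add: funpow_Suc_right vimage_comp del: funpow.simps)
  ultimately show ?case by metis
qed

text \<open>Continuity of the next iterate can fail at \<open>x\<close> only if
  \<open>\<beta> * x\<close> is an integer or \<open>beta_map \<beta> x\<close> is a discontinuity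
  of the previous iterate.\<close>

lemma countable_not_isCont_beta_map:
  assumes "\<beta> \<noteq> 0"
  shows "countable {x. \<not> isCont (beta_map \<beta> ^^ n) x}"
proof (induction n)
  case (Suc n)
  have cont: "isCont (beta_map \<beta>) x" if "\<beta> * x \<notin> \<int>" for x
    unfolding beta_map_def
    by (rule isCont_o2[of x "\<lambda>x. \<beta> * x" frac]) (use that in \<open>auto intro: continuous_frac\<close>)
  have "isCont (beta_map \<beta> ^^ Suc n) x" 
    if "isCont (beta_map \<beta> ^^ n) (beta_map \<beta> x)" "\<beta> * x \<notin> \<int>" for x
    using continuous_at_compose[OF cont[OF that(2)] that(1)] by (simp add: funpow_Suc_right del: funpow.simps)
  then have "{x. \<not> isCont (beta_map \<beta> ^^ Suc n) x} \<subseteq>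
      (beta_map \<beta> ^^ 1) -` {x. \<not> isCont (beta_map \<beta> ^^ n) x} \<union> (\<lambda>m. m / \<beta>) ` \<int>"
  proof (intro subsetI)
    fix x assume *: "x \<in> {x. \<not> isCont (beta_map \<beta> ^^ Suc n) x}"
    have "x \<in> (\<lambda>m. m / \<beta>) ` \<int>" if "\<beta> * x \<in> \<int>"
      using that assms by (intro image_eqI[of _ _ "\<beta> * x"]) auto
    then show "x \<in> (beta_map \<beta> ^^ 1) -` {x. \<not> isCont (beta_map \<beta> ^^ n) x} \<union> (\<lambda>m. m / \<beta>) ` \<int>"
      using * \<open>\<And>x. isCont (beta_map \<beta> ^^ n) (beta_map \<beta> x) \<Longrightarrow> \<beta> * x \<notin> \<int> \<Longrightarrow> isCont (beta_map \<beta> ^^ Suc n) x\<close>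
      by auto
  qed
  moreover have "countable ((beta_map \<beta> ^^ 1) -` {x. \<not> isCont (beta_map \<beta> ^^ n) x})"
    using countable_beta_map_vimage[OF assms Suc] .
  moreover have "countable (\<int> :: real set)" unfolding Ints_def by simp
  ultimately show ?case by (meson countable_Un countable_image countable_subset)
qed simp

section \<open>Level sets of the iterates\<close>

text \<open>The sets whose limsup is \<open>beta_approx\<close>, named so that their interiors can
  replace them.\<close>

definition beta_level :: "real \<Rightarrow> real \<Rightarrow> nat \<Rightarrow> real set" where
  "beta_level \<beta> \<kappa> n = {x \<in> {0..1}. 0 \<le> (beta_map \<beta> ^^ n) x \<and> (beta_map \<beta> ^^ n) x \<le> \<beta> powr (- \<kappa> * real n)}"

text \<open>On a full branch starting at \<open>y\<close> the iterate is
  \<open>\<beta> ^ n * (u - y)\<close>, which stays below the threshold over a length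
  \<open>\<beta> powr (- (1 + \<kappa>) * n)\<close>. The strict bound on \<open>h\<close> leaves
  room for a closed interval inside the open one.\<close>

lemma beta_level_contains_interval:
  assumes \<beta>: "1 < \<beta>" "\<beta> \<le> 2" and \<kappa>: "0 < \<kappa>"
    and x: "0 \<le> x" "x + (real n + 1) / \<beta> ^ n \<le> 1"
    and h: "0 < h" "h < \<beta> powr (- (1 + \<kappa>) * real n)"
  shows "\<exists>y. {y..y + h} \<subseteq> {x..x + (real n + 1) / \<beta> ^ n} \<inter> interior (beta_level \<beta> \<kappa> n)"
proof -
  define R where "R = \<beta> powr (- (1 + \<kappa>) * real n)"
  have pow: "\<beta> ^ n = \<beta> powr real n" using \<beta> by (simp add: powr_realpow)
  have R: "\<beta> ^ n * R = \<beta> powr (- \<kappa> * real n)"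
    using \<beta> by (simp add: R_def pow powr_add[symmetric] algebra_simps)
  have "\<beta> powr (- \<kappa> * real n) \<le> \<beta> powr 0" using \<beta> \<kappa> by (intro powr_mono) auto
  then have "R \<le> 1 / \<beta> ^ n" using R \<beta> by (simp add: field_simps)
  obtain y where y: "x \<le> y" "y + 1 / \<beta> ^ n \<le> x + (real n + 1) / \<beta> ^ n"
    and lin: "\<And>z. 0 \<le> z \<Longrightarrow> z < 1 / \<beta> ^ n \<Longrightarrow> (beta_map \<beta> ^^ n) (y + z) = \<beta> ^ n * z"
    using beta_map_full_branch[OF \<beta> x] by blast
  have "{y<..<y + R} \<subseteq> beta_level \<beta> \<kappa> n"
  proof
    fix u assume u: "u \<in> {y<..<y + R}"
    then have "(beta_map \<beta> ^^ n) u = \<beta> ^ n * (u - y)"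
      using lin[of "u - y"] \<open>R \<le> 1 / \<beta> ^ n\<close> by simp
    moreover have "\<beta> ^ n * (u - y) \<le> \<beta> ^ n * R" using u \<beta> by (intro mult_left_mono) auto
    ultimately show "u \<in> beta_level \<beta> \<kappa> n"
      using u x y \<beta> R \<open>R \<le> 1 / \<beta> ^ n\<close> unfolding beta_level_def by auto
  qed
  then have "{y<..<y + R} \<subseteq> interior (beta_level \<beta> \<kappa> n)" by (simp add: interior_maximal)
  moreover have "{y + (R - h) / 2..y + (R - h) / 2 + h} \<subseteq> {y<..<y + R}"
  proof -
    have "h < R" using h by (simp add: R_def)
    then have *: "y < y + (R - h) / 2" "y + (R - h) / 2 + h < y + R" by (simp_all add: field_simps)
    show ?thesis
    proof
      fix v assume "v \<in> {y + (R - h) / 2..y + (R - h) / 2 + h}"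
      then show "v \<in> {y<..<y + R}" using * unfolding atLeastAtMost_iff greaterThanLessThan_iff by linarith
    qed
  qed
  moreover have "{y<..<y + R} \<subseteq> {x..x + (real n + 1) / \<beta> ^ n}"
    using y \<open>R \<le> 1 / \<beta> ^ n\<close> by auto
  ultimately show ?thesis by (intro exI[of _ "y + (R - h) / 2"]) blast
qed

text \<open>The scale is \<open>2 * D n\<close> for large \<open>n\<close>. Because
  \<open>1 / t > 1 + \<kappa>\<close>, the required length is exponentially smaller than the
  available one, which absorbs \<open>n + 1\<close> and any \<open>C\<close>.\<close>

lemma ubiquitous_beta_levels:
  assumes \<beta>: "1 < \<beta>" "\<beta> \<le> 2" and \<kappa>: "0 < \<kappa>" and t: "0 < t" "t < 1 / (1 + \<kappa>)"
  shows "ubiquitous t (\<Union>n\<in>{N..}. \<Union>k::int. (\<lambda>x. x + of_int k) ` interior (beta_level \<beta> \<kappa> n))"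
    (is "ubiquitous t ?G")
  unfolding ubiquitous_def
proof (intro allI impI)
  fix C \<epsilon> :: real assume C: "0 < C" and \<epsilon>: "0 < \<epsilon>"
  define D where "D n = (real n + 1) / \<beta> ^ n" for n
  have D_pos: "0 < D n" for n using \<beta> by (simp add: D_def)
  have "1 + \<kappa> < 1 / t" using t \<kappa> by (simp add: field_simps)
  have lnb: "0 < ln \<beta>" using \<beta> by simp
  have D_exp: "D n = (real n + 1) * exp (- ln \<beta> * real n)" for n
    using \<beta> by (simp add: D_def powr_realpow[symmetric] powr_def exp_minus divide_inverse mult.commute)
  have "((\<lambda>n. D n) \<longlongrightarrow> 0) at_top"
    unfolding D_exp using lnb by real_asymp
  then have "eventually (\<lambda>n. D n < min (\<epsilon> / 2) 1) at_top"
    using \<epsilon> by (intro order_tendstoD) auto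
  moreover have "eventually (\<lambda>n. C * (2 * D n) powr (1 / t) < \<beta> powr (- (1 + \<kappa>) * real n)) at_top"
  proof -
    \<comment> \<open>The exponential rate gained from the strict inequality for
      \<open>t\<close>.\<close>
    define \<delta> where "\<delta> = (1 / t - (1 + \<kappa>)) * ln \<beta>"
    have \<delta>: "0 < \<delta>" using \<open>1 + \<kappa> < 1 / t\<close> lnb by (simp add: \<delta>_def)
    have "((\<lambda>n. C * (2 * (real n + 1)) powr (1 / t) * exp (- \<delta> * real n)) \<longlongrightarrow> 0) at_top"
      using \<delta> C t by real_asymp
    then have "eventually (\<lambda>n. C * (2 * (real n + 1)) powr (1 / t) * exp (- \<delta> * real n) < 1) at_top"
      by (rule order_tendstoD) simp
    then show ?thesis
    proof eventually_elim
      case (elim n)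
      have "C * (2 * D n) powr (1 / t) =
          C * (2 * (real n + 1)) powr (1 / t) * exp (- \<delta> * real n) * exp (- (1 + \<kappa>) * real n * ln \<beta>)"
        unfolding D_exp mult.assoc[symmetric, of 2] powr_mult
        by (simp add: powr_def \<delta>_def exp_add[symmetric] algebra_simps diff_divide_distrib)
      also have "\<dots> < 1 * exp (- (1 + \<kappa>) * real n * ln \<beta>)"
        using elim by (intro mult_strict_right_mono) auto
      finally show ?case using \<beta> by (simp add: powr_def)
    qed
  qed
  moreover have "eventually (\<lambda>n. N \<le> n) at_top" by (rule eventually_ge_at_top)
  ultimately have "eventually (\<lambda>n. D n < min (\<epsilon> / 2) 1 \<and>
      C * (2 * D n) powr (1 / t) < \<beta> powr (- (1 + \<kappa>) * real n) \<and> N \<le> n) at_top"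
    by eventually_elim auto
  then obtain n where n: "D n < \<epsilon> / 2" "D n < 1" "N \<le> n"
      and h: "C * (2 * D n) powr (1 / t) < \<beta> powr (- (1 + \<kappa>) * real n)"
    using eventually_happens'[OF sequentially_bot] by auto
  define h where "h = C * (2 * D n) powr (1 / t)"
  have hpos: "0 < h" using C D_pos[of n] by (simp add: h_def)
  have unit: "\<exists>y. {y..y + h} \<subseteq> {x..x + D n} \<inter> ?G" if "of_int k \<le> x" "x + D n \<le> of_int k + 1" for x and k :: int
  proof -
    have x: "0 \<le> x - of_int k" "x - of_int k + D n \<le> 1" using that by linarith+
    obtain y where y: "{y..y + h} \<subseteq> {x - of_int k..x - of_int k + D n} \<inter> interior (beta_level \<beta> \<kappa> n)"
      using beta_level_contains_interval[OF \<beta> \<kappa>, folded D_def, OF x hpos h[folded h_def]] by blast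
    have "v \<in> {x..x + D n} \<inter> ?G" if "v \<in> {y + of_int k..y + of_int k + h}" for v
    proof -
      have v: "v - of_int k \<in> {x - of_int k..x - of_int k + D n} \<inter> interior (beta_level \<beta> \<kappa> n)"
        using that by (intro subsetD[OF y]) auto
      moreover have "v = (v - of_int k) + of_int k" by simp
      ultimately have "v \<in> (\<lambda>x. x + of_int k) ` interior (beta_level \<beta> \<kappa> n)" by blast
      moreover have "v \<in> {x..x + D n}" using v by auto
      ultimately show ?thesis using n(3) by blast
    qed
    then show ?thesis by blast
  qed
  have "\<exists>y. {y..y + h} \<subseteq> {x..x + 2 * D n} \<inter> ?G" for x
  proof (cases "x + D n \<le> of_int \<lfloor>x\<rfloor> + 1")
    case True
    obtain y where "{y..y + h} \<subseteq> {x..x + D n} \<inter> ?G" using unit[OF of_int_floor_le True] by blast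
    moreover have "{x..x + D n} \<subseteq> {x..x + 2 * D n}" using D_pos[of n] by auto
    ultimately show ?thesis by blast
  next
    case False
    \<comment> \<open>An integer lies less than \<open>D n\<close> to the right of \<open>x\<close>;
      starting there avoids crossing a boundary of the periodic pattern, at the price of the factor
      2.\<close>
    obtain y where "{y..y + h} \<subseteq> {of_int (\<lfloor>x\<rfloor> + 1)..of_int (\<lfloor>x\<rfloor> + 1) + D n} \<inter> ?G"
      using unit[of "\<lfloor>x\<rfloor> + 1" "of_int (\<lfloor>x\<rfloor> + 1)"] n(2) by auto
    moreover have "x \<le> of_int (\<lfloor>x\<rfloor> + 1)" by linarith
    then have "{of_int (\<lfloor>x\<rfloor> + 1)..of_int (\<lfloor>x\<rfloor> + 1) + D n} \<subseteq> {x..x + 2 * D n}" using False by auto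
    ultimately show ?thesis by blast
  qed
  then show "\<exists>d>0. d < \<epsilon> \<and> (\<forall>x. \<exists>y. {y..y + C * d powr (1 / t)} \<subseteq> {x..x + d} \<inter> ?G)"
    using n(1) D_pos[of n] unfolding h_def by (intro exI[of _ "2 * D n"]) auto
qed

text \<open>At a point of \<open>{0<..<1}\<close> where the iterate is continuous and strictly below
  the threshold, the defining inequalities persist nearby. The remaining points form the countable
  set \<open>S\<close>.\<close>

lemma countable_beta_level_diff_interior:
  assumes \<beta>: "1 < \<beta>"
  shows "countable (beta_level \<beta> \<kappa> n - interior (beta_level \<beta> \<kappa> n))"
proof -
  define c where "c = \<beta> powr (- \<kappa> * real n)"
  define S where "S = {0, 1} \<union> {x. \<not> isCont (beta_map \<beta> ^^ n) x} \<union> (beta_map \<beta> ^^ n) -` {c}"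
  have nonneg: "0 \<le> (beta_map \<beta> ^^ n) x" if "0 \<le> x" for x
    using that by (cases n) (simp_all add: beta_map_def[of \<beta> "(beta_map \<beta> ^^ _) x"])
  have "countable S"
    using \<beta> unfolding S_def
    by (intro countable_Un countable_not_isCont_beta_map countable_beta_map_vimage) auto
  moreover have "x \<in> interior (beta_level \<beta> \<kappa> n)" if x: "x \<in> beta_level \<beta> \<kappa> n" "x \<notin> S" for x
  proof -
    have *: "isCont (beta_map \<beta> ^^ n) x" "(beta_map \<beta> ^^ n) x < c" "0 < x" "x < 1"
      using x by (auto simp: S_def beta_level_def c_def less_le)
    have "eventually (\<lambda>y. (beta_map \<beta> ^^ n) y < c) (nhds x)"
      using *(1,2) by (intro order_tendstoD(2)) (auto simp: continuous_at tendsto_at_iff_tendsto_nhds)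
    moreover have "eventually (\<lambda>y. y \<in> {0<..<1}) (nhds x)"
      using * by (intro eventually_nhds_in_open) auto
    ultimately have "eventually (\<lambda>y. y \<in> beta_level \<beta> \<kappa> n) (nhds x)"
      by eventually_elim (auto simp: beta_level_def c_def nonneg)
    then show ?thesis by (simp add: eventually_nhds interior_def) blast
  qed
  ultimately show ?thesis by (meson Diff_iff countable_subset subsetI)
qed

section \<open>Periodic limsup sets and large intersections\<close>

text \<open>Distinct integer translates of \<open>{0<..<1}\<close> are disjoint, so the shift is
  \<open>\<lfloor>z\<rfloor>\<close> for every \<open>n\<close> and the union over shifts commutes
  with the limsup.\<close>

lemma int_translates_limsup:
  fixes I :: "nat \<Rightarrow> real set"
  assumes I: "\<And>n. I n \<subseteq> {0<..<1}"
  shows "(\<Union>k::int. (\<lambda>x. x + of_int k) ` (\<Inter>N. \<Union>n\<in>{N..}. I n)) =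
         (\<Inter>N. \<Union>n\<in>{N..}. \<Union>k::int. (\<lambda>x. x + of_int k) ` I n)"
    (is "?L = ?R")
proof
  show "?L \<subseteq> ?R" by auto blast
  show "?R \<subseteq> ?L"
  proof
    fix z assume z: "z \<in> ?R"
    have "z - of_int \<lfloor>z\<rfloor> \<in> (\<Union>n\<in>{N..}. I n)" for N
    proof -
      obtain n k x where n: "N \<le> n" and x: "x \<in> I n" and zx: "z = x + of_int k"
        using INT_D[OF z UNIV_I, of N] by auto
      have "0 < x" "x < 1" using x I[of n] by auto
      then have "\<lfloor>z\<rfloor> = k" unfolding zx by linarith
      then show ?thesis using n x zx by auto
    qed
    then have "z - of_int \<lfloor>z\<rfloor> \<in> (\<Inter>N. \<Union>n\<in>{N..}. I n)" by blast
    moreover have "z = (z - of_int \<lfloor>z\<rfloor>) + of_int \<lfloor>z\<rfloor>" by simp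
    ultimately show "z \<in> ?L" by blast
  qed
qed

theorem theorem4:
  fixes \<beta> \<kappa> :: real
  assumes "1 < \<beta>" and "\<beta> \<le> 2" and "0 < \<kappa>"
  shows "\<exists>B \<in> large_int_class_on (1 / (1 + \<kappa>)) {0..1}.
           B \<subseteq> beta_approx \<beta> \<kappa> \<and> countable (beta_approx \<beta> \<kappa> - B)"
proof -
  define E where "E = beta_level \<beta> \<kappa>"
  define B where "B = (\<Inter>N. \<Union>n\<in>{N..}. interior (E n))"
  define V where "V N = (\<Union>n\<in>{N..}. \<Union>k::int. (\<lambda>x. x + of_int k) ` interior (E n))" for N
  have approx: "beta_approx \<beta> \<kappa> = (\<Inter>N. \<Union>n\<in>{N..}. E n)"
    unfolding beta_approx_def E_def beta_level_def INFM_nat_le by auto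
  have "interior (E n) \<subseteq> interior {0..1}" for n
    by (intro interior_mono) (auto simp: E_def beta_level_def)
  then have E01: "interior (E n) \<subseteq> {0<..<1}" for n by simp
  have periodic: "(\<Union>k::int. (\<lambda>x. x + diameter {0..1::real} * of_int k) ` B) = (\<Inter>N. V N)"
    using int_translates_limsup[of "\<lambda>n. interior (E n)"] E01
    by (simp add: B_def V_def)
  have openV: "open (V N)" for N
  proof -
    have "open ((\<lambda>x. x + of_int k) ` interior (E n))" for n and k :: int
      using open_translation[OF open_interior, of "of_int k" "E n"] by (simp add: add.commute)
    then show ?thesis unfolding V_def by (intro open_UN ballI)
  qed
  have ubV: "ubiquitous t (V N)" if "0 < t" "t < 1 / (1 + \<kappa>)" for t N
    unfolding V_def E_def by (rule ubiquitous_beta_levels[OF assms that])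
  have dim: "ereal (1 / (1 + \<kappa>)) \<le> hausdorff_dim (\<Inter>f\<in>F. f ` (\<Inter>N. V N))"
    if F: "countable F" "\<And>f. f \<in> F \<Longrightarrow> similarity f" for F :: "(real \<Rightarrow> real) set"
  proof (rule hausdorff_dim_ge_of_ubiquitous)
    \<comment> \<open>Adding \<open>range V\<close> keeps the family nonempty when \<open>F\<close>
      is empty, where the intersection over \<open>F\<close> is the whole line.\<close>
    let ?F = "range V \<union> (\<lambda>(f, N). f ` V N) ` (F \<times> UNIV)"
    show "countable ?F" using F(1) by (intro countable_Un countable_image countable_SIGMA) auto
    show "?F \<noteq> {}" by blast
    \<comment> \<open>Injectivity lets images commute with the intersection over \<open>N\<close>,
      which reduces everything to one countable family of ubiquitous sets.\<close>
    have "inj f" if "f \<in> F" for f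
      using F(2)[OF that] unfolding similarity_def inj_def by (metis dist_eq_0_iff mult_eq_0_iff less_irrefl)
    then have "f ` (\<Inter>N. V N) = (\<Inter>N. f ` V N)" if "f \<in> F" for f
      using that by (intro image_INT[of f UNIV]) auto
    then show "\<Inter>?F \<subseteq> (\<Inter>f\<in>F. f ` (\<Inter>N. V N))" by auto
    show "ubiquitous t G" if "G \<in> ?F" "0 < t" "t < 1 / (1 + \<kappa>)" for G t
      using that ubV[OF that(2,3)] ubiquitous_similarity F(2) by auto
  qed (use assms in auto)
  have "gdelta (\<Inter>N. V N)" using openV by (rule gdelta.intros)
  then have "(\<Inter>N. V N) \<in> large_int_class (1 / (1 + \<kappa>))"
    using dim unfolding large_int_class_def by auto
  moreover have "B \<subseteq> {0..1}" using E01 by (force simp: B_def)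
  ultimately have "B \<in> large_int_class_on (1 / (1 + \<kappa>)) {0..1}"
    unfolding large_int_class_on_def mem_Collect_eq periodic by blast
  moreover have "B \<subseteq> beta_approx \<beta> \<kappa>"
    unfolding approx B_def using interior_subset by blast
  moreover have "countable (beta_approx \<beta> \<kappa> - B)"
  proof (rule countable_subset)
    show "beta_approx \<beta> \<kappa> - B \<subseteq> (\<Union>n. E n - interior (E n))"
      unfolding approx B_def by blast
    show "countable (\<Union>n. E n - interior (E n))"
      unfolding E_def using countable_beta_level_diff_interior[OF assms(1)] by auto
  qed
  ultimately show ?thesis by blast
qed

end
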